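(* Let $(\mathcal{F},X)$ be a dynamical network with graph of interactions $\Gamma_{\mathcal{F}}$, and suppose $A$ is a stability matrix of $(\mathcal{F},X)$. If $\rho(A)<1$, then for every complete structural set $S$ of $\Gamma_{\mathcal{F}}$ the restriction $(\mathcal{R}_S\mathcal{F},X|_S)$ has a globally attracting fixed point.
   Context: Dynamical networks. $\mathcal{I}=\{1,\dots,n\}$; for $i\in\mathcal{I}$, $(X_i,d)$ is a complete metric space and $\varphi_i:X_i\to X_i$ satisfies $L_i=\sup_{x\neq y}d(\varphi_i(x),\varphi_i(y))/d(x,y)<\infty$. $X=\prod_iX_i$ with $d_{max}(\mathbf{x},\mathbf{y})=\max_id(x_i,y_i)$, $\varphi=(\varphi_1,\dots,\varphi_n)$ acting coordinatewise. An interaction is a map $F:X\to X$ such that for each $j$ there are a nonempty $\mathcal{I}_j\subseteq\mathcal{I}$ and a continuous $F_j:\prod_{i\in\mathcal{I}_j}X_i\to X_j$ with $F(\mathbf{x})_j=F_j(\mathbf{x}|_{\mathcal{I}_j})$. The dynamical network is $(\mathcal{F},X)$ with $\mathcal{F}=F\circ\varphi$; its component $\mathcal{F}_j$ is a function of the variables $x_i$, $i\in\mathcal{I}_j$. A stability matrix of $(\mathcal{F},X)$ is a matrix $\Lambda^T\cdot\mathrm{diag}[L_1,\dots,L_n]$ where $\Lambda\in\mathbb{R}^{n\times n}$, $\Lambda_{ij}\ge0$, $\Lambda_{ij}=0$ if $i\notin\mathcal{I}_j$, and $d(F_j(\mathbf{x}|_{\mathcal{I}_j}),F_j(\mathbf{y}|_{\mathcal{I}_j}))\le\sum_{i\in\mathcal{I}_j}\Lambda_{ij}d(x_i,y_i)$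 for all $j$ and all $\mathbf{x},\mathbf{y}\in X$. $\rho$ is the spectral radius. Graph. $\Gamma_{\mathcal{F}}$ is the directed graph with vertices $V=\{v_1,\dots,v_n\}$ and an edge $e_{ij}$ from $v_i$ to $v_j$ iff $i\in\mathcal{I}_j$. A path is a sequence of distinct vertices, consecutive ones joined by edges in the given direction; a cycle is the same with first and last vertex equal and otherwise distinct vertices (a loop at a vertex is a cycle). $S\subseteq V$ is a complete structural set if every cycle of $\Gamma_{\mathcal{F}}$ contains a vertex of $S$ and every vertex of $V$ belongs to a path or cycle that begins and ends at vertices of $S$. Put $\mathcal{I}_S=\{i:v_i\in S\}$. Restriction. For $j\in\mathcal{I}_S$ let $\mathcal{F}_{(j,0)}=\mathcal{F}_j$, and for $i\ge1$ let $\mathcal{F}_{(j,i)}$ be obtained from $\mathcal{F}_{(j,i-1)}$ by replacing every variable $x_\ell$ with $\ell\notin\mathcal{I}_S$ by the function $\mathcal{F}_\ell$. Once all variables are indexed by $\mathcal{I}_S$ (which happens after finitely many steps), the resulting function is $\mathcal{R}_S\mathcal{F}_j$. The restriction is $(\mathcal{R}_S\mathcal{F},X|_S)$ with $X|_S=\prod_{i\in\mathcal{I}_S}X_i$ and $\mathcal{R}_S\mathcal{F}=(\mathcal{R}_S\mathcal{F}_j)_{j\in\mathcal{I}_S}$. A network $(\mathcal{G},Y)$ has a globally attracting fixed point $\tilde{\mathbf{y}}$ if $\tilde{\mathbf y}$ is a fixed point and $\lim_{k\to\infty}d_{max}(\mathcal{G}^k(\mathbf{y}),\tilde{\mathbf{y}})=0$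 for every $\mathbf{y}\in Y$. *)

theory Defs
  imports
    "HOL-Analysis.Analysis"
    "Jordan_Normal_Form.Spectral_Radius"
    "Graph_Theory.Arc_Walk"
begin

text \<open>
  The index set is \<open>{..<n}\<close>. The spaces \<open>X i\<close> may differ from each other; they are
  carrier sets inside one type \<open>'a\<close>, each with its own metric \<open>d i\<close>. Points of
  \<open>\<Prod>i\<in>J. X i\<close> are the extensional functions in \<open>Pi\<^sub>E J X\<close>.
\<close>

text \<open>
  The element 0 inserted below only matters when \<open>M\<close> has at most one point, where
  the supremum over pairs of distinct points is 0 by convention.
\<close>

definition lipschitz_quotients :: "'a set \<Rightarrow> ('a \<Rightarrow> 'a \<Rightarrow> real) \<Rightarrow> ('a \<Rightarrow> 'a) \<Rightarrow> real set" where
  "lipschitz_quotients M d f = {d (f x) (f y) / d x y | x y. x \<in> M \<and> y \<in> M \<and> x \<noteq> y}"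

definition lipschitz_const :: "'a set \<Rightarrow> ('a \<Rightarrow> 'a \<Rightarrow> real) \<Rightarrow> ('a \<Rightarrow> 'a) \<Rightarrow> real" where
  "lipschitz_const M d f = Sup (insert 0 (lipschitz_quotients M d f))"

text \<open>
  \<open>\<I> j\<close> is the set of indices on which the \<open>j\<close>-th component \<open>F j\<close> of the interaction
  depends. On a finite product, the product topology is the one induced by the
  maximum metric.
\<close>

locale dynamical_network =
  fixes n :: nat
    and X :: "nat \<Rightarrow> 'a set"
    and d :: "nat \<Rightarrow> 'a \<Rightarrow> 'a \<Rightarrow> real"
    and \<phi> :: "nat \<Rightarrow> 'a \<Rightarrow> 'a"
    and \<I> :: "nat \<Rightarrow> nat set"
    and F :: "nat \<Rightarrow> (nat \<Rightarrow> 'a) \<Rightarrow> 'a"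
  assumes n_pos: "n > 0"
    and metric: "\<And>i. i < n \<Longrightarrow> Metric_space (X i) (d i)"
    and complete: "\<And>i. i < n \<Longrightarrow> Metric_space.mcomplete (X i) (d i)"
    and space_nonempty: "\<And>i. i < n \<Longrightarrow> X i \<noteq> {}"
    and local_maps: "\<And>i. i < n \<Longrightarrow> \<phi> i \<in> X i \<rightarrow> X i"
    and local_lipschitz: "\<And>i. i < n \<Longrightarrow> bdd_above (lipschitz_quotients (X i) (d i) (\<phi> i))"
    and index_subset: "\<And>j. j < n \<Longrightarrow> \<I> j \<subseteq> {..<n}"
    and index_nonempty: "\<And>j. j < n \<Longrightarrow> \<I> j \<noteq> {}"
    and interaction_continuous: "\<And>j. j < n \<Longrightarrow>
      continuous_map (product_topology (\<lambda>i. Metric_space.mtopology (X i) (d i)) (\<I> j))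
        (Metric_space.mtopology (X j) (d j)) (F j)"

definition interaction ::
    "nat \<Rightarrow> (nat \<Rightarrow> nat set) \<Rightarrow> (nat \<Rightarrow> (nat \<Rightarrow> 'a) \<Rightarrow> 'a) \<Rightarrow> (nat \<Rightarrow> 'a) \<Rightarrow> nat \<Rightarrow> 'a" where
  "interaction n \<I> F x = (\<lambda>j\<in>{..<n}. F j (restrict x (\<I> j)))"

definition network_map ::
    "nat \<Rightarrow> (nat \<Rightarrow> 'a \<Rightarrow> 'a) \<Rightarrow> (nat \<Rightarrow> nat set) \<Rightarrow> (nat \<Rightarrow> (nat \<Rightarrow> 'a) \<Rightarrow> 'a) \<Rightarrow>
      (nat \<Rightarrow> 'a) \<Rightarrow> nat \<Rightarrow> 'a" where
  "network_map n \<phi> \<I> F = interaction n \<I> F \<circ> (\<lambda>x. \<lambda>i\<in>{..<n}. \<phi> i (x i))"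

text \<open>The component \<open>\<F>\<^sub>j\<close>, as a function of the variables \<open>x\<^sub>i\<close> with \<open>i \<in> \<I> j\<close> alone:\<close>

definition component ::
    "(nat \<Rightarrow> 'a \<Rightarrow> 'a) \<Rightarrow> (nat \<Rightarrow> nat set) \<Rightarrow> (nat \<Rightarrow> (nat \<Rightarrow> 'a) \<Rightarrow> 'a) \<Rightarrow>
      nat \<Rightarrow> (nat \<Rightarrow> 'a) \<Rightarrow> 'a" where
  "component \<phi> \<I> F j x = F j (\<lambda>i\<in>\<I> j. \<phi> i (x i))"

lemma (in dynamical_network) network_map_component:
  assumes "j < n"
  shows "network_map n \<phi> \<I> F x j = component \<phi> \<I> F j (restrict x (\<I> j))"
proof -
  have "restrict (\<lambda>i\<in>{..<n}. \<phi> i (x i)) (\<I> j) = (\<lambda>i\<in>\<I> j. \<phi> i (restrict x (\<I> j) i))"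
    using index_subset[OF assms] by (auto simp: fun_eq_iff)
  then show ?thesis
    using assms by (simp add: network_map_def interaction_def component_def)
qed

definition stability_matrix ::
    "nat \<Rightarrow> (nat \<Rightarrow> 'a set) \<Rightarrow> (nat \<Rightarrow> 'a \<Rightarrow> 'a \<Rightarrow> real) \<Rightarrow> (nat \<Rightarrow> 'a \<Rightarrow> 'a) \<Rightarrow>
      (nat \<Rightarrow> nat set) \<Rightarrow> (nat \<Rightarrow> (nat \<Rightarrow> 'a) \<Rightarrow> 'a) \<Rightarrow> real mat \<Rightarrow> bool" where
  "stability_matrix n X d \<phi> \<I> F A \<longleftrightarrow>
    (\<exists>\<Lambda> \<in> carrier_mat n n.
      (\<forall>i<n. \<forall>j<n. 0 \<le> \<Lambda> $$ (i, j)) \<and>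
      (\<forall>i<n. \<forall>j<n. i \<notin> \<I> j \<longrightarrow> \<Lambda> $$ (i, j) = 0) \<and>
      (\<forall>j<n. \<forall>x \<in> Pi\<^sub>E {..<n} X. \<forall>y \<in> Pi\<^sub>E {..<n} X.
        d j (F j (restrict x (\<I> j))) (F j (restrict y (\<I> j)))
          \<le> (\<Sum>i\<in>\<I> j. \<Lambda> $$ (i, j) * d i (x i) (y i))) \<and>
      A = transpose_mat \<Lambda> * mat_diag n (\<lambda>i. lipschitz_const (X i) (d i) (\<phi> i)))"

definition interaction_graph :: "nat \<Rightarrow> (nat \<Rightarrow> nat set) \<Rightarrow> (nat, nat \<times> nat) pre_digraph" where
  "interaction_graph n \<I> =
    \<lparr>verts = {..<n}, arcs = {(i, j). j < n \<and> i \<in> \<I> j}, tail = fst, head = snd\<rparr>"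

text \<open>
  A cycle is a list of arcs, and its vertices are the tails of these arcs. A loop is a
  cycle; an \<open>apath\<close> (distinct vertices) may consist of a single vertex.
\<close>

definition complete_structural_set :: "('v, 'e) pre_digraph \<Rightarrow> 'v set \<Rightarrow> bool" where
  "complete_structural_set G S \<longleftrightarrow>
    S \<subseteq> verts G \<and>
    (\<forall>p. pre_digraph.cycle G p \<longrightarrow> (\<exists>e \<in> set p. tail G e \<in> S)) \<and>
    (\<forall>v \<in> verts G.
      (\<exists>s \<in> S. \<exists>t \<in> S. \<exists>p. pre_digraph.apath G s p t \<and> v \<in> set (pre_digraph.awalk_verts G s p)) \<or>
      (\<exists>s \<in> S. \<exists>p. pre_digraph.cycle G p \<and> pre_digraph.awalk G s p s \<and>
         v \<in> set (pre_digraph.awalk_verts G s p)))"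

text \<open>
  \<open>subst_vars \<I> S j m\<close> is the set of indices of the variables of \<open>\<F>\<^sub>(\<^sub>j\<^sub>,\<^sub>m\<^sub>)\<close>, and
  \<open>subst_fun \<phi> \<I> F S j m\<close> is \<open>\<F>\<^sub>(\<^sub>j\<^sub>,\<^sub>m\<^sub>)\<close> as a function of these variables. One step replaces
  simultaneously every variable \<open>x\<^sub>l\<close> with \<open>l \<notin> S\<close> by \<open>\<F>\<^sub>l\<close>, whose variables are indexed
  by \<open>\<I> l\<close>.
\<close>

primrec subst_vars :: "(nat \<Rightarrow> nat set) \<Rightarrow> nat set \<Rightarrow> nat \<Rightarrow> nat \<Rightarrow> nat set" where
  "subst_vars \<I> S j 0 = \<I> j"
| "subst_vars \<I> S j (Suc m) =
    (subst_vars \<I> S j m \<inter> S) \<union> (\<Union>l \<in> subst_vars \<I> S j m - S. \<I> l)"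

primrec subst_fun ::
    "(nat \<Rightarrow> 'a \<Rightarrow> 'a) \<Rightarrow> (nat \<Rightarrow> nat set) \<Rightarrow> (nat \<Rightarrow> (nat \<Rightarrow> 'a) \<Rightarrow> 'a) \<Rightarrow>
      nat set \<Rightarrow> nat \<Rightarrow> nat \<Rightarrow> (nat \<Rightarrow> 'a) \<Rightarrow> 'a" where
  "subst_fun \<phi> \<I> F S j 0 = component \<phi> \<I> F j"
| "subst_fun \<phi> \<I> F S j (Suc m) =
    (\<lambda>x. subst_fun \<phi> \<I> F S j m
      (\<lambda>l \<in> subst_vars \<I> S j m. if l \<in> S then x l else component \<phi> \<I> F l x))"

text \<open>
  If \<open>S\<close> is a complete structural set, no cycle avoids \<open>S\<close>, so the number of steps
  below exists. Further steps would not change the function.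
\<close>

definition restriction ::
    "(nat \<Rightarrow> 'a \<Rightarrow> 'a) \<Rightarrow> (nat \<Rightarrow> nat set) \<Rightarrow> (nat \<Rightarrow> (nat \<Rightarrow> 'a) \<Rightarrow> 'a) \<Rightarrow>
      nat set \<Rightarrow> (nat \<Rightarrow> 'a) \<Rightarrow> nat \<Rightarrow> 'a" where
  "restriction \<phi> \<I> F S x =
    (\<lambda>j\<in>S. subst_fun \<phi> \<I> F S j (LEAST m. subst_vars \<I> S j m \<subseteq> S) x)"

definition dmax :: "'i set \<Rightarrow> ('i \<Rightarrow> 'a \<Rightarrow> 'a \<Rightarrow> real) \<Rightarrow> ('i \<Rightarrow> 'a) \<Rightarrow> ('i \<Rightarrow> 'a) \<Rightarrow> real" where
  "dmax J d x y = Max ((\<lambda>i. d i (x i) (y i)) ` J)"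

definition globally_attracting_fixed_point ::
    "'b set \<Rightarrow> ('b \<Rightarrow> 'b \<Rightarrow> real) \<Rightarrow> ('b \<Rightarrow> 'b) \<Rightarrow> 'b \<Rightarrow> bool" where
  "globally_attracting_fixed_point Y D G z \<longleftrightarrow>
    z \<in> Y \<and> G z = z \<and> (\<forall>y \<in> Y. (\<lambda>k. D ((G ^^ k) y) z) \<longlonglongrightarrow> 0)"

end

theory Submission
  imports Defs "Graph_Theory.Digraph_Component"
begin

text \<open>
  Everything rests on one choice of norm. If \<open>A\<close> is nonnegative and \<open>\<rho>(A) < 1\<close>, then there
  are weights \<open>w > 0\<close> and \<open>0 < \<theta> < 1\<close> with \<open>A w \<le> \<theta> w\<close>
  (\<open>nonneg_mat_subinvariant_weights\<close>). Measure the \<open>i\<close>-th coordinate by \<open>d i / w i\<close>. If two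
  points are at distance at most \<open>c\<close> in each weighted coordinate, then \<open>A w \<le> \<theta> w\<close> says
  that each component \<open>\<F>\<^sub>j\<close> brings them within \<open>\<theta> c\<close> in the weighted \<open>j\<close>-th coordinate
  (\<open>component_weighted_contraction\<close>).

  Such a bound survives substitution. Replacing a variable \<open>x\<^sub>l\<close> by \<open>\<F>\<^sub>l\<close> replaces a
  coordinate distance of at most \<open>c\<close> by one of at most \<open>\<theta> c \<le> c\<close>, so all functions
  \<open>\<F>\<^sub>(\<^sub>j\<^sub>,\<^sub>m\<^sub>)\<close> contract by \<open>\<theta>\<close> in the same sense (\<open>subst_fun_weighted_contraction\<close>).
  One and the same pair \<open>w\<close>, \<open>\<theta>\<close> thus serves the network and all its restrictions.

  That \<open>S\<close> is a complete structural set makes the substitution terminate. No cycle avoids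
  \<open>S\<close>, so the arcs between vertices outside \<open>S\<close> form a well-founded relation, and
  after finitely many steps only variables indexed by \<open>S\<close> remain
  (\<open>complete_structural_set_subst_vars\<close>). Hence the restriction maps \<open>\<Prod>i\<in>S. X i\<close> to itself
  and is a contraction for the weighted maximum metric, which is complete. The contraction
  principle yields a fixed point that attracts every orbit, and this remains true for the
  unweighted maximum metric, which is at most \<open>Max (w ` S)\<close> times the weighted one.
\<close>

section \<open>Weights for a nonnegative matrix of spectral radius less than 1\<close>

lemma pow_mat_smult:
  fixes A :: "'a :: comm_semiring_1 mat"
  assumes "A \<in> carrier_mat n n"
  shows "(c \<cdot>\<^sub>m A) ^\<^sub>m k = c ^ k \<cdot>\<^sub>m A ^\<^sub>m k"
proof (induction k)
  case 0
  show ?case using assms by (intro eq_matI) auto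
next
  case (Suc k)
  have "(c ^ k \<cdot>\<^sub>m A ^\<^sub>m k) * (c \<cdot>\<^sub>m A) = c ^ Suc k \<cdot>\<^sub>m (A ^\<^sub>m k * A)"
    using assms
    by (simp add: mult_smult_distrib[of _ n n _ n] mult_smult_assoc_mat[of _ n n _ n]
        pow_carrier_mat[OF assms]) (intro eq_matI; simp add: ac_simps)
  then show ?case using Suc by simp
qed

lemma pow_mat_Suc_left:
  fixes A :: "'a :: semiring_1 mat"
  assumes "A \<in> carrier_mat n n"
  shows "A ^\<^sub>m Suc k = A * A ^\<^sub>m k"
proof (induction k)
  case 0
  show ?case using assms by simp
next
  case (Suc k)
  have "A ^\<^sub>m Suc (Suc k) = (A * A ^\<^sub>m k) * A"
    using Suc by simp
  also have "\<dots> = A * (A ^\<^sub>m k * A)"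
    using assms by (intro assoc_mult_mat[of _ n n _ n _ n]) auto
  finally show ?case by simp
qed

lemma spectral_radius_divide_less_1:
  assumes "A \<in> carrier_mat n n" and "0 < n" and "0 < r" and "spectral_radius A < r"
  shows "spectral_radius (complex_of_real (1 / r) \<cdot>\<^sub>m A) < 1"
proof -
  let ?B = "complex_of_real (1 / r) \<cdot>\<^sub>m A"
  have B: "?B \<in> carrier_mat n n" using assms by simp
  from spectral_radius_mem_max(1)[OF B assms(2)] obtain k v where
    k: "spectral_radius ?B = norm k" and v: "eigenvector ?B v k"
    by (auto simp: spectrum_def eigenvalue_def)
  have vc: "v \<in> carrier_vec n" using v assms by (simp add: eigenvector_def)
  have Av: "complex_of_real (1 / r) \<cdot>\<^sub>v (A *\<^sub>v v) = k \<cdot>\<^sub>v v"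
  proof -
    have "?B *\<^sub>v v = complex_of_real (1 / r) \<cdot>\<^sub>v (A *\<^sub>v v)"
      using assms(1) vc by (intro eq_vecI) (auto simp: scalar_prod_def sum_distrib_left mult.assoc)
    then show ?thesis using v by (simp add: eigenvector_def)
  qed
  have "A *\<^sub>v v = (of_real r * k) \<cdot>\<^sub>v v"
  proof -
    have "A *\<^sub>v v = of_real r \<cdot>\<^sub>v (complex_of_real (1 / r) \<cdot>\<^sub>v (A *\<^sub>v v))"
      using assms(3) by (simp add: smult_smult_assoc flip: of_real_mult)
    then show ?thesis by (simp only: Av smult_smult_assoc)
  qed
  then have "of_real r * k \<in> spectrum A"
    using v assms(1) by (auto simp: spectrum_def eigenvalue_def eigenvector_def)
  then have "norm (of_real r * k) \<le> spectral_radius A"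
    using spectral_radius_mem_max(2)[OF assms(1,2)] by blast
  then have "r * norm k \<le> spectral_radius A" using assms(3) by (simp add: norm_mult)
  then have "r * norm k < r * 1" using assms(4) by linarith
  then show ?thesis using assms(3) unfolding k by (simp only: mult_less_cancel_left_pos)
qed

lemma spectral_radius_nonneg:
  assumes "A \<in> carrier_mat n n" and "0 < n"
  shows "0 \<le> spectral_radius A"
  using spectral_radius_mem_max(1)[OF assms] by auto

text \<open>
  For \<open>\<rho>(A) < 1\<close> the powers of \<open>A\<close> are known to be bounded. Applied to \<open>A / r\<close> with
  \<open>\<rho>(A) < r < 1\<close>, which still has spectral radius below 1, this bounds \<open>A\<^sup>k\<close> by a multiple
  of \<open>r\<^sup>k\<close>.
\<close>

lemma spectral_radius_less_1_powers_tendsto_0: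
  assumes A: "A \<in> carrier_mat n n" and "spectral_radius A < 1" and "i < n" and "j < n"
  shows "(\<lambda>k. (A ^\<^sub>m k) $$ (i, j)) \<longlonglongrightarrow> 0"
proof -
  have "0 < n" using assms by simp
  obtain r where r: "spectral_radius A < r" "r < 1" using assms dense by blast
  have "0 < r" using r spectral_radius_nonneg[OF A \<open>0 < n\<close>] by simp
  let ?B = "complex_of_real (1 / r) \<cdot>\<^sub>m A"
  obtain c where c: "\<And>k. norm_bound (?B ^\<^sub>m k) c"
    using spectral_radius_jnf_norm_bound_less_1_upper_triangular
      [OF _ spectral_radius_divide_less_1[OF A \<open>0 < n\<close> \<open>0 < r\<close> r(1)]] A by fastforce
  have "norm ((A ^\<^sub>m k) $$ (i, j)) \<le> c * r ^ k" for k
  proof -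
    have "norm ((?B ^\<^sub>m k) $$ (i, j)) \<le> c"
      using c[of k] assms pow_carrier_mat[OF A, of k]
      by (simp add: norm_bound_def pow_mat_smult[OF A])
    then have "(1 / r) ^ k * norm ((A ^\<^sub>m k) $$ (i, j)) \<le> c"
      using assms pow_carrier_mat[OF A, of k] \<open>0 < r\<close>
      by (simp add: pow_mat_smult[OF A] norm_mult norm_power norm_divide)
    then show ?thesis using \<open>0 < r\<close> by (simp add: field_simps)
  qed
  moreover have "(\<lambda>k. c * r ^ k) \<longlonglongrightarrow> 0"
    using \<open>0 < r\<close> r(2) by (intro tendsto_mult_right_zero LIMSEQ_realpow_zero) auto
  ultimately show ?thesis by (rule Lim_null_comparison[OF always_eventually[OF allI]])
qed

text \<open>
  Take \<open>\<rho>(A) < \<theta> < 1\<close> and \<open>B = A / \<theta>\<close>, and let \<open>u k = B\<^sup>k 1\<close> be the vector of row sums of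
  \<open>B\<^sup>k\<close>. For \<open>w = u 0 + \<dots> + u (K - 1)\<close> the sum telescopes to \<open>B w = w - u 0 + u K\<close>. Since
  \<open>u 0 = 1\<close> and \<open>u k\<close> tends to 0, large \<open>K\<close> gives \<open>B w \<le> w\<close>. A truncated Neumann series thus
  does the work of a Perron eigenvector and, unlike the latter, is strictly positive even
  when \<open>A\<close> is reducible.
\<close>

lemma nonneg_mat_subinvariant_weights:
  fixes A :: "real mat"
  assumes A: "A \<in> carrier_mat n n" and "0 < n"
    and nonneg: "\<And>i j. i < n \<Longrightarrow> j < n \<Longrightarrow> 0 \<le> A $$ (i, j)"
    and rho: "spectral_radius (map_mat complex_of_real A) < 1"
  obtains w \<theta> where "0 < \<theta>" and "\<theta> < 1" and "\<And>i. i < n \<Longrightarrow> 0 < w i"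
    and "\<And>i. i < n \<Longrightarrow> (\<Sum>j<n. A $$ (i, j) * w j) \<le> \<theta> * w i"
proof -
  let ?c = "map_mat complex_of_real"
  have cA: "?c A \<in> carrier_mat n n" using A by simp
  obtain \<theta> where \<theta>: "spectral_radius (?c A) < \<theta>" "\<theta> < 1" using rho dense by blast
  have "0 < \<theta>" using \<theta> spectral_radius_nonneg[OF cA \<open>0 < n\<close>] by simp
  define B where "B = (1 / \<theta>) \<cdot>\<^sub>m A"
  have B: "B \<in> carrier_mat n n" using A by (simp add: B_def)
  have B_nonneg: "0 \<le> B $$ (i, j)" if "i < n" "j < n" for i j
    using that nonneg A \<open>0 < \<theta>\<close> by (simp add: B_def)
  have cB: "?c B = complex_of_real (1 / \<theta>) \<cdot>\<^sub>m ?c A"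
    unfolding B_def using A by (intro eq_matI) auto
  have rho_B: "spectral_radius (?c B) < 1"
    unfolding cB by (rule spectral_radius_divide_less_1[OF cA \<open>0 < n\<close> \<open>0 < \<theta>\<close> \<theta>(1)])
  have lim: "(\<lambda>k. (B ^\<^sub>m k) $$ (i, j)) \<longlonglongrightarrow> 0" if "i < n" "j < n" for i j
  proof -
    have "(?c B ^\<^sub>m k) $$ (i, j) = complex_of_real ((B ^\<^sub>m k) $$ (i, j))" for k
      using that carrier_matD[OF B]
      by (subst of_real_hom.mat_hom_pow[OF B, symmetric]) simp
    then have "(\<lambda>k. complex_of_real ((B ^\<^sub>m k) $$ (i, j))) \<longlonglongrightarrow> of_real 0"
      using spectral_radius_less_1_powers_tendsto_0[of "?c B" n i j] that rho_B B
      by simp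
    then show ?thesis by (simp only: tendsto_of_real_iff)
  qed
  define u where "u k i = (\<Sum>j<n. (B ^\<^sub>m k) $$ (i, j))" for k i
  have u_0: "u 0 i = 1" if "i < n" for i
    using that B by (simp add: u_def if_distrib cong: if_cong)
  have u_Suc: "u (Suc k) i = (\<Sum>l<n. B $$ (i, l) * u k l)" if "i < n" for k i
  proof -
    have "u (Suc k) i = (\<Sum>j<n. \<Sum>l<n. B $$ (i, l) * (B ^\<^sub>m k) $$ (l, j))"
      unfolding u_def pow_mat_Suc_left[OF B] using that B pow_carrier_mat[OF B, of k]
      by (intro sum.cong) (auto simp: scalar_prod_def lessThan_atLeast0)
    also have "\<dots> = (\<Sum>l<n. B $$ (i, l) * u k l)"
      unfolding u_def sum_distrib_left by (rule sum.swap)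
    finally show ?thesis .
  qed
  have u_nonneg: "0 \<le> u k i" if "i < n" for k i
    using that
    by (induction k arbitrary: i) (auto simp: u_0 u_Suc B_nonneg intro!: sum_nonneg mult_nonneg_nonneg)
  have u_lim: "(\<lambda>k. u k i) \<longlonglongrightarrow> 0" if "i < n" for i
    unfolding u_def using that by (intro tendsto_null_sum lim) auto
  have "eventually (\<lambda>k. u k i < 1) sequentially" if "i < n" for i
    using u_lim[OF that] by (rule order_tendstoD) simp
  then have "eventually (\<lambda>k. \<forall>i\<in>{..<n}. u k i < 1) sequentially"
    by (intro eventually_ball_finite) auto
  then have "eventually (\<lambda>k. 0 < k \<and> (\<forall>i\<in>{..<n}. u k i < 1)) sequentially"
    using eventually_gt_at_top[of 0] by eventually_elim auto
  \<comment> \<open>The condition \<open>0 < K\<close> keeps the summand \<open>u 0 = 1\<close>, which makes \<open>w\<close> positive.\<close>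
  then obtain K where K: "0 < K" "\<And>i. i < n \<Longrightarrow> u K i < 1"
    by (auto dest!: eventually_happens)
  define w where "w i = (\<Sum>k<K. u k i)" for i
  have "0 < w i" if "i < n" for i
  proof -
    have "u 0 i \<le> w i"
      unfolding w_def using K(1) that by (intro member_le_sum) (auto simp: u_nonneg)
    then show ?thesis using u_0[OF that] by simp
  qed
  moreover have "(\<Sum>j<n. A $$ (i, j) * w j) \<le> \<theta> * w i" if "i < n" for i
  proof -
    have "(\<Sum>j<n. A $$ (i, j) * w j) = \<theta> * (\<Sum>j<n. \<Sum>k<K. B $$ (i, j) * u k j)"
      using A that \<open>0 < \<theta>\<close> by (simp add: B_def w_def sum_distrib_left)
    also have "(\<Sum>j<n. \<Sum>k<K. B $$ (i, j) * u k j) = (\<Sum>k<K. u (Suc k) i)"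
      unfolding u_Suc[OF that] by (rule sum.swap)
    also have "\<dots> = w i + u K i - u 0 i"
      unfolding w_def using sum.lessThan_Suc_shift[of "\<lambda>k. u k i" K] by simp
    also have "\<theta> * (w i + u K i - u 0 i) \<le> \<theta> * w i"
      using K(2)[OF that] u_0[OF that] \<open>0 < \<theta>\<close> by (intro mult_left_mono) auto
    finally show ?thesis .
  qed
  ultimately show ?thesis using that \<open>0 < \<theta>\<close> \<theta>(2) by blast
qed

section \<open>Complete maximum metrics and contractions\<close>

lemma Metric_space_divide:
  assumes "Metric_space M d" and "0 < (c::real)"
  shows "Metric_space M (\<lambda>x y. d x y / c)"
proof -
  interpret Metric_space M d by fact
  show ?thesis
  proof
    fix x y z assume "x \<in> M" "y \<in> M" "z \<in> M"
    then show "d x z / c \<le> d x y / c + d y z / c"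
      using triangle assms(2) by (simp add: divide_right_mono flip: add_divide_distrib)
  qed (use assms(2) in \<open>auto simp: commute\<close>)
qed

lemma mcomplete_divide:
  assumes "Metric_space M d" and "Metric_space.mcomplete M d" and c: "0 < (c::real)"
  shows "Metric_space.mcomplete M (\<lambda>x y. d x y / c)"
proof -
  interpret Metric_space M d by fact
  interpret D: Metric_space M "\<lambda>x y. d x y / c"
    using Metric_space_divide assms by blast
  show ?thesis
    unfolding D.mcomplete_def
  proof (intro allI impI)
    fix \<sigma> assume s: "D.MCauchy \<sigma>"
    have "MCauchy \<sigma>"
      unfolding MCauchy_def
    proof (intro conjI allI impI)
      fix \<epsilon> :: real assume "0 < \<epsilon>"
      then have "0 < \<epsilon> / c" using c by simp
      then obtain N where "\<forall>n n'. N \<le> n \<longrightarrow> N \<le> n' \<longrightarrow> d (\<sigma> n) (\<sigma> n') / c < \<epsilon> / c"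
        using s unfolding D.MCauchy_def by blast
      then show "\<exists>N. \<forall>n n'. N \<le> n \<longrightarrow> N \<le> n' \<longrightarrow> d (\<sigma> n) (\<sigma> n') < \<epsilon>"
        using c by (auto simp: divide_less_cancel)
    qed (use s in \<open>simp add: D.MCauchy_def\<close>)
    then obtain l where l: "limitin mtopology \<sigma> l sequentially"
      using assms(2) by (auto simp: mcomplete_def)
    have "limitin D.mtopology \<sigma> l sequentially"
      unfolding D.limit_metric_sequentially
    proof (intro conjI allI impI)
      fix \<epsilon> :: real assume "0 < \<epsilon>"
      then have "0 < \<epsilon> * c" using c by simp
      then show "\<exists>N. \<forall>n\<ge>N. \<sigma> n \<in> M \<and> d (\<sigma> n) l / c < \<epsilon>"
        using l c unfolding limit_metric_sequentially by (simp add: pos_divide_less_eq)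
    qed (use l in \<open>simp add: limit_metric_sequentially\<close>)
    then show "\<exists>l. limitin D.mtopology \<sigma> l sequentially" ..
  qed
qed

lemma dmax_le_iff:
  assumes "finite J" and "J \<noteq> {}"
  shows "dmax J d x y \<le> c \<longleftrightarrow> (\<forall>i\<in>J. d i (x i) (y i) \<le> c)"
  using assms by (simp add: dmax_def)

lemma dmax_less_iff:
  assumes "finite J" and "J \<noteq> {}"
  shows "dmax J d x y < c \<longleftrightarrow> (\<forall>i\<in>J. d i (x i) (y i) < c)"
  using assms by (simp add: dmax_def)

lemma le_dmax:
  assumes "finite J" and "i \<in> J"
  shows "d i (x i) (y i) \<le> dmax J d x y"
  using assms by (simp add: dmax_def)

lemma Metric_space_dmax:
  assumes J: "finite J" "J \<noteq> {}" and M: "\<And>i. i \<in> J \<Longrightarrow> Metric_space (X i) (d i)"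
  shows "Metric_space (Pi\<^sub>E J X) (dmax J d)"
proof
  have nonneg: "0 \<le> d i a b" if "i \<in> J" for i a b
    using M[OF that] by (rule Metric_space.nonneg)
  obtain i\<^sub>0 where "i\<^sub>0 \<in> J" using J(2) by blast
  show pos: "0 \<le> dmax J d x y" for x y
    using nonneg[OF \<open>i\<^sub>0 \<in> J\<close>] le_dmax[OF J(1) \<open>i\<^sub>0 \<in> J\<close>] by (rule order_trans)
  show "dmax J d x y = dmax J d y x" for x y
    using Metric_space.commute[OF M] by (simp add: dmax_def cong: image_cong)
  show "dmax J d x y = 0 \<longleftrightarrow> x = y" if "x \<in> Pi\<^sub>E J X" "y \<in> Pi\<^sub>E J X" for x y
  proof -
    have "dmax J d x y = 0 \<longleftrightarrow> dmax J d x y \<le> 0" using pos[of x y] by auto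
    also have "\<dots> \<longleftrightarrow> (\<forall>i\<in>J. d i (x i) (y i) = 0)"
      unfolding dmax_le_iff[OF J] using nonneg by (intro ball_cong refl) (simp add: order_eq_iff)
    also have "\<dots> \<longleftrightarrow> (\<forall>i\<in>J. x i = y i)"
      using that by (auto simp: Metric_space.zero[OF M] PiE_mem)
    also have "\<dots> \<longleftrightarrow> x = y" using that by (auto intro: PiE_ext)
    finally show ?thesis .
  qed
  show "dmax J d x z \<le> dmax J d x y + dmax J d y z"
    if "x \<in> Pi\<^sub>E J X" "y \<in> Pi\<^sub>E J X" "z \<in> Pi\<^sub>E J X" for x y z
    unfolding dmax_le_iff[OF J]
  proof
    fix i assume i: "i \<in> J"
    have "d i (x i) (z i) \<le> d i (x i) (y i) + d i (y i) (z i)"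
      using that i by (intro Metric_space.triangle[OF M]) (auto simp: PiE_mem)
    then show "d i (x i) (z i) \<le> dmax J d x y + dmax J d y z"
      using le_dmax[OF J(1) i, of d x y] le_dmax[OF J(1) i, of d y z] by linarith
  qed
qed

lemma mcomplete_dmax:
  assumes J: "finite J" "J \<noteq> {}" and M: "\<And>i. i \<in> J \<Longrightarrow> Metric_space (X i) (d i)"
    and complete: "\<And>i. i \<in> J \<Longrightarrow> Metric_space.mcomplete (X i) (d i)"
  shows "Metric_space.mcomplete (Pi\<^sub>E J X) (dmax J d)"
proof -
  interpret P: Metric_space "Pi\<^sub>E J X" "dmax J d"
    using Metric_space_dmax[OF J M] .
  show ?thesis
    unfolding P.mcomplete_def
  proof (intro allI impI)
    fix \<sigma> assume s: "P.MCauchy \<sigma>"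
    have s_mem: "\<sigma> k \<in> Pi\<^sub>E J X" for k using s unfolding P.MCauchy_def by blast
    have "\<exists>l. limitin (Metric_space.mtopology (X i) (d i)) (\<lambda>k. \<sigma> k i) l sequentially"
      if i: "i \<in> J" for i
    proof -
      have "Metric_space.MCauchy (X i) (d i) (\<lambda>k. \<sigma> k i)"
        unfolding Metric_space.MCauchy_def[OF M[OF i]]
      proof (intro conjI allI impI)
        show "range (\<lambda>k. \<sigma> k i) \<subseteq> X i" using s_mem i by (auto simp: PiE_mem)
        fix \<epsilon> :: real assume "0 < \<epsilon>"
        then obtain N where "\<And>k k'. N \<le> k \<Longrightarrow> N \<le> k' \<Longrightarrow> dmax J d (\<sigma> k) (\<sigma> k') < \<epsilon>"
          using s unfolding P.MCauchy_def by blast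
        then show "\<exists>N. \<forall>k k'. N \<le> k \<longrightarrow> N \<le> k' \<longrightarrow> d i (\<sigma> k i) (\<sigma> k' i) < \<epsilon>"
          using i by (auto simp: dmax_less_iff[OF J])
      qed
      then show ?thesis
        using complete[OF i] by (simp add: Metric_space.mcomplete_def[OF M[OF i]])
    qed
    then obtain l where l: "\<And>i. i \<in> J \<Longrightarrow>
        limitin (Metric_space.mtopology (X i) (d i)) (\<lambda>k. \<sigma> k i) (l i) sequentially"
      by metis
    have l_mem: "l i \<in> X i" if "i \<in> J" for i
      using l[OF that] by (simp add: Metric_space.limit_metric_sequentially[OF M[OF that]])
    have "limitin P.mtopology \<sigma> (restrict l J) sequentially"
      unfolding P.limitin_metric
    proof (intro conjI allI impI)
      show "restrict l J \<in> Pi\<^sub>E J X" using l_mem by auto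
      fix \<epsilon> :: real assume "0 < \<epsilon>"
      have "\<forall>\<^sub>F k in sequentially. \<forall>i\<in>J. \<sigma> k i \<in> X i \<and> d i (\<sigma> k i) (l i) < \<epsilon>"
      proof (intro eventually_ball_finite J ballI)
        fix i assume "i \<in> J"
        then show "\<forall>\<^sub>F k in sequentially. \<sigma> k i \<in> X i \<and> d i (\<sigma> k i) (l i) < \<epsilon>"
          using l[OF \<open>i \<in> J\<close>] \<open>0 < \<epsilon>\<close>
          by (simp add: Metric_space.limitin_metric[OF M[OF \<open>i \<in> J\<close>]])
      qed
      then show "\<forall>\<^sub>F k in sequentially. \<sigma> k \<in> Pi\<^sub>E J X \<and> dmax J d (\<sigma> k) (restrict l J) < \<epsilon>"
        by eventually_elim (simp add: s_mem dmax_less_iff[OF J])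
    qed
    then show "\<exists>l. limitin P.mtopology \<sigma> l sequentially"
      by (rule exI[of _ "restrict l J"])
  qed
qed

text \<open>
  The contraction principle in the form needed here: besides a fixed point \<open>z\<close> it gives
  convergence of all orbits, because \<open>d (f\<^sup>m y) z \<le> k\<^sup>m d y z\<close>.
\<close>

lemma (in Metric_space) contraction_globally_attracting:
  assumes "mcomplete" and "M \<noteq> {}" and f: "f \<in> M \<rightarrow> M"
    and k: "0 \<le> k" "k < 1"
    and con: "\<And>x y. x \<in> M \<Longrightarrow> y \<in> M \<Longrightarrow> d (f x) (f y) \<le> k * d x y"
  obtains z where "globally_attracting_fixed_point M d f z"
proof -
  obtain z where z: "z \<in> M" "f z = z"
    using Banach_fixedpoint_thm[OF assms(1-3) k(2) con] by blast
  have "(\<lambda>m. d ((f ^^ m) y) z) \<longlonglongrightarrow> 0" if y: "y \<in> M" for y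
  proof -
    have iter: "(f ^^ m) y \<in> M \<and> d ((f ^^ m) y) z \<le> k ^ m * d y z" for m
    proof (induction m)
      case (Suc m)
      have "d (f ((f ^^ m) y)) z \<le> k * d ((f ^^ m) y) z"
        using con[of "(f ^^ m) y" z] Suc z by simp
      also have "\<dots> \<le> k * (k ^ m * d y z)" using Suc k by (intro mult_left_mono) auto
      finally show ?case using Suc f by (auto simp: mult.assoc)
    qed (use y in simp)
    have "(\<lambda>m. k ^ m * d y z) \<longlonglongrightarrow> 0"
      using k by (intro tendsto_mult_left_zero LIMSEQ_realpow_zero) auto
    moreover have "norm (d ((f ^^ m) y) z) \<le> k ^ m * d y z" for m
      using iter by simp
    ultimately show ?thesis
      by (rule Lim_null_comparison[OF always_eventually[OF allI], rotated])
  qed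
  with z show ?thesis
    by (intro that[of z]) (simp add: globally_attracting_fixed_point_def)
qed

section \<open>Cycles and the termination of the substitution\<close>

text \<open>
  An infinite descent along arcs that stay outside \<open>S\<close> would, in a finite graph, close up to
  a closed walk and hence contain a cycle outside \<open>S\<close>. The walk is
  shortened to a cycle within the subgraph induced by the complement of \<open>S\<close>, so that the
  cycle avoids \<open>S\<close> as well.
\<close>

lemma (in wf_digraph) wf_arcs_avoiding_transversal:
  assumes "finite (arcs G)" and transversal: "\<And>p. cycle p \<Longrightarrow> \<exists>e\<in>set p. tail G e \<in> S"
  shows "wf {(tail G e, head G e) | e. e \<in> arcs G \<and> tail G e \<notin> S \<and> head G e \<notin> S}"
    (is "wf ?r")
proof -
  let ?H = "G \<restriction> (verts G - S)"
  interpret H: wf_digraph ?H by (rule wellformed_induce_subgraph)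
  have ends: "?r = arcs_ends ?H"
    by (auto simp: arcs_ends_conv intro!: wellformed)
  have "\<not> H.cycle p" for p
  proof
    assume p: "H.cycle p"
    have "subgraph ?H G" using induced_induce[of "verts G - S"] by (auto simp: induced_subgraph_def)
    then have "cycle p" using p by (rule subgraph_cycle)
    then obtain e where "e \<in> set p" "tail G e \<in> S" using transversal by blast
    moreover have "set p \<subseteq> arcs ?H" using p unfolding H.cycle_def H.awalk_def by blast
    ultimately show False by auto
  qed
  then have "\<not> H.closed_w p" for p using H.closed_w_imp_cycle by blast
  then have "acyclic ?r"
    unfolding ends acyclic_def H.reachable1_awalk by (auto simp: H.closed_w_def)
  moreover have "finite ?r"
    using assms(1) by (rule finite_surj[of _ _ "\<lambda>e. (tail G e, head G e)"]) auto
  ultimately show ?thesis by (simp add: finite_acyclic_wf)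
qed

text \<open>
  One step of the substitution acts on index sets by a map \<open>T\<close> that commutes with unions, so
  it suffices to follow single indices. For these, well-founded induction applies: an index
  \<open>l \<notin> S\<close> is replaced by the finite set \<open>\<I> l\<close>, whose members lie in \<open>S\<close> or are smaller. The
  maximum of their step numbers works for all of them at once because subsets of \<open>S\<close> are
  fixed by \<open>T\<close>.
\<close>

lemma ex_subst_vars_subset:
  assumes wf: "wf {(i, l). l \<in> V \<and> i \<in> \<I> l \<and> i \<notin> S \<and> l \<notin> S}"
    and V: "finite V" "\<And>l. l \<in> V \<Longrightarrow> \<I> l \<subseteq> V" and j: "j \<in> V"
  shows "\<exists>m. subst_vars \<I> S j m \<subseteq> S"
proof -
  define T where "T W = (W \<inter> S) \<union> (\<Union>l\<in>W - S. \<I> l)" for W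
  have vars: "subst_vars \<I> S j m = (T ^^ m) (\<I> j)" for m
    by (induction m) (simp_all add: T_def)
  have T_UN: "T (\<Union>i\<in>W. f i) = (\<Union>i\<in>W. T (f i))" for W :: "nat set" and f
    by (auto simp: T_def)
  have iter_UN: "(T ^^ m) W = (\<Union>i\<in>W. (T ^^ m) {i})" for m W
    by (induction m) (simp_all add: T_UN)
  have stable: "(T ^^ m') W \<subseteq> S" if "m \<le> m'" "(T ^^ m) W \<subseteq> S" for m m' W
    using that by (induction rule: dec_induct) (auto simp: T_def)
  have finite_UN: "\<exists>m. (T ^^ m) W \<subseteq> S"
    if "finite W" and ex: "\<And>i. i \<in> W \<Longrightarrow> \<exists>m. (T ^^ m) {i} \<subseteq> S" for W
  proof -
    obtain f where f: "\<And>i. i \<in> W \<Longrightarrow> (T ^^ f i) {i} \<subseteq> S" using ex by metis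
    have "(T ^^ Max (f ` W)) {i} \<subseteq> S" if "i \<in> W" for i
      using stable[OF _ f[OF that]] that \<open>finite W\<close> by simp
    then have "(T ^^ Max (f ` W)) W \<subseteq> S"
      unfolding iter_UN[of _ W] by blast
    then show ?thesis ..
  qed
  have single: "l \<in> V \<Longrightarrow> \<exists>m. (T ^^ m) {l} \<subseteq> S" for l
  proof (induction l rule: wf_induct_rule[OF wf])
    case (1 l)
    have in_S: "\<exists>m. (T ^^ m) {i} \<subseteq> S" if "i \<in> S" for i
      using that by (intro exI[of _ 0]) simp
    show ?case
    proof (cases "l \<in> S")
      case True
      then show ?thesis by (rule in_S)
    next
      case False
      have "\<exists>m. (T ^^ m) {i} \<subseteq> S" if "i \<in> \<I> l" for i
        using in_S[of i] 1 that False V(2)[of l] by auto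
      then obtain m where "(T ^^ m) (\<I> l) \<subseteq> S"
        using finite_UN[OF finite_subset[OF V(2)[OF 1(2)] V(1)]] by auto
      moreover have "T {l} = \<I> l" using False by (auto simp: T_def)
      ultimately have "(T ^^ Suc m) {l} \<subseteq> S" by (simp add: funpow_Suc_right del: funpow.simps)
      then show ?thesis ..
    qed
  qed
  show ?thesis
    unfolding vars
  proof (rule finite_UN)
    show "finite (\<I> j)" using V(2)[OF j] V(1) by (rule finite_subset)
    show "\<exists>m. (T ^^ m) {i} \<subseteq> S" if "i \<in> \<I> j" for i
      using V(2)[OF j] that by (intro single) auto
  qed
qed

lemma (in dynamical_network) complete_structural_set_subst_vars:
  assumes S: "complete_structural_set (interaction_graph n \<I>) S" and j: "j < n"
  shows "\<exists>m. subst_vars \<I> S j m \<subseteq> S"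
proof -
  let ?G = "interaction_graph n \<I>"
  interpret wf_digraph ?G
    by unfold_locales (auto simp: interaction_graph_def dest: index_subset[THEN subsetD])
  have arcs_sub: "arcs ?G \<subseteq> {..<n} \<times> {..<n}"
    by (auto simp: interaction_graph_def dest: index_subset[THEN subsetD])
  have transversal: "\<exists>e\<in>set p. tail ?G e \<in> S" if "cycle p" for p
    using S that by (auto simp: complete_structural_set_def)
  have "wf {(tail ?G e, head ?G e) | e. e \<in> arcs ?G \<and> tail ?G e \<notin> S \<and> head ?G e \<notin> S}"
    using finite_subset[OF arcs_sub] transversal by (intro wf_arcs_avoiding_transversal) auto
  moreover have "{(tail ?G e, head ?G e) | e. e \<in> arcs ?G \<and> tail ?G e \<notin> S \<and> head ?G e \<notin> S}
      = {(i, l). l \<in> {..<n} \<and> i \<in> \<I> l \<and> i \<notin> S \<and> l \<notin> S}"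
    by (auto simp: interaction_graph_def)
  ultimately show ?thesis
    using j index_subset by (intro ex_subst_vars_subset[of "{..<n}"]) auto
qed

section \<open>Contraction estimates for networks\<close>

context dynamical_network
begin

lemma local_map_lipschitz:
  assumes i: "i < n" and xy: "a \<in> X i" "b \<in> X i"
  shows "d i (\<phi> i a) (\<phi> i b) \<le> lipschitz_const (X i) (d i) (\<phi> i) * d i a b"
proof (cases "a = b")
  case True
  then show ?thesis
    using xy local_maps[OF i] Metric_space.mdist_zero[OF metric[OF i]] by (simp add: Pi_iff)
next
  case False
  then have "0 < d i a b"
    using xy Metric_space.mdist_pos_less[OF metric[OF i]] by blast
  moreover have "d i (\<phi> i a) (\<phi> i b) / d i a b \<le> lipschitz_const (X i) (d i) (\<phi> i)"
    unfolding lipschitz_const_def using xy False local_lipschitz[OF i]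
    by (intro cSup_upper) (auto simp: lipschitz_quotients_def)
  ultimately show ?thesis by (simp add: pos_divide_le_eq)
qed

lemma lipschitz_const_nonneg:
  assumes "i < n"
  shows "0 \<le> lipschitz_const (X i) (d i) (\<phi> i)"
  unfolding lipschitz_const_def using local_lipschitz[OF assms] by (intro cSup_upper) auto

lemma component_in_space:
  assumes j: "j < n" and x: "\<And>i. i \<in> \<I> j \<Longrightarrow> x i \<in> X i"
  shows "component \<phi> \<I> F j x \<in> X j"
proof -
  have ts: "topspace (Metric_space.mtopology (X i) (d i)) = X i" if "i < n" for i
    using Metric_space.topspace_mtopology[OF metric[OF that]] .
  have "F j \<in> (\<Pi>\<^sub>E i\<in>\<I> j. X i) \<rightarrow> X j"
    using continuous_map_funspace[OF interaction_continuous[OF j]] index_subset[OF j] j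
    by (simp add: ts subset_iff cong: PiE_cong)
  moreover have "(\<lambda>i\<in>\<I> j. \<phi> i (x i)) \<in> (\<Pi>\<^sub>E i\<in>\<I> j. X i)"
    using x local_maps index_subset[OF j] by (auto simp: Pi_iff)
  ultimately show ?thesis unfolding component_def by (rule funcset_mem)
qed

lemma stability_matrix_carrier:
  assumes "stability_matrix n X d \<phi> \<I> F A"
  shows "A \<in> carrier_mat n n"
  using assms by (auto simp: stability_matrix_def)

lemma stability_matrix_nonneg:
  assumes "stability_matrix n X d \<phi> \<I> F A" and "i < n" "j < n"
  shows "0 \<le> A $$ (i, j)"
  using assms lipschitz_const_nonneg
  by (auto simp: stability_matrix_def mat_diag_mult_right[of _ n n])

text \<open>
  The estimate in the definition of a stability matrix concerns points of the whole product,
  whereas a component only sees the coordinates in \<open>\<I> j\<close>. As all \<open>X i\<close> are nonempty, every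
  assignment on \<open>\<I> j\<close> extends to such a point, and the Lipschitz constants of the local maps
  turn \<open>\<Lambda>\<close> into \<open>A\<close>.
\<close>

lemma stability_matrix_component:
  assumes A: "stability_matrix n X d \<phi> \<I> F A" and j: "j < n"
    and x: "\<And>i. i \<in> \<I> j \<Longrightarrow> x i \<in> X i" and y: "\<And>i. i \<in> \<I> j \<Longrightarrow> y i \<in> X i"
  shows "d j (component \<phi> \<I> F j x) (component \<phi> \<I> F j y)
    \<le> (\<Sum>i\<in>\<I> j. A $$ (j, i) * d i (x i) (y i))"
proof -
  let ?L = "\<lambda>i. lipschitz_const (X i) (d i) (\<phi> i)"
  obtain \<Lambda> where \<Lambda>: "\<Lambda> \<in> carrier_mat n n" "\<forall>i<n. \<forall>j<n. 0 \<le> \<Lambda> $$ (i, j)"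
    and bound: "\<forall>j<n. \<forall>u \<in> Pi\<^sub>E {..<n} X. \<forall>v \<in> Pi\<^sub>E {..<n} X.
        d j (F j (restrict u (\<I> j))) (F j (restrict v (\<I> j)))
          \<le> (\<Sum>i\<in>\<I> j. \<Lambda> $$ (i, j) * d i (u i) (v i))"
    and A_eq: "A = transpose_mat \<Lambda> * mat_diag n ?L"
    using A unfolding stability_matrix_def by (elim bexE conjE) (rule that)
  have lt: "i < n" if "i \<in> \<I> j" for i using that index_subset[OF j] by auto
  define ext where
    "ext z = (\<lambda>i\<in>{..<n}. if i \<in> \<I> j then \<phi> i (z i) else (SOME a. a \<in> X i))" for z
  have ext_mem: "ext z \<in> Pi\<^sub>E {..<n} X" if "\<And>i. i \<in> \<I> j \<Longrightarrow> z i \<in> X i" for z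
    using that local_maps space_nonempty by (auto simp: ext_def Pi_iff some_in_eq)
  have ext_eq: "restrict (ext z) (\<I> j) = (\<lambda>i\<in>\<I> j. \<phi> i (z i))" for z
    using lt by (auto simp: ext_def fun_eq_iff)
  have "d j (component \<phi> \<I> F j x) (component \<phi> \<I> F j y)
      \<le> (\<Sum>i\<in>\<I> j. \<Lambda> $$ (i, j) * d i (ext x i) (ext y i))"
    using bound[rule_format, OF j ext_mem[OF x] ext_mem[OF y]] by (simp add: component_def ext_eq)
  also have "\<dots> \<le> (\<Sum>i\<in>\<I> j. A $$ (j, i) * d i (x i) (y i))"
  proof (rule sum_mono)
    fix i assume i: "i \<in> \<I> j"
    have "\<Lambda> $$ (i, j) * d i (ext x i) (ext y i) \<le> \<Lambda> $$ (i, j) * (?L i * d i (x i) (y i))"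
      using i lt[OF i] j x y \<Lambda>(2) local_map_lipschitz[OF lt[OF i]]
      by (intro mult_left_mono) (simp_all add: ext_def)
    also have "\<dots> = A $$ (j, i) * d i (x i) (y i)"
      unfolding A_eq using \<Lambda>(1) lt[OF i] j by (simp add: mat_diag_mult_right[of _ n n])
    finally show "\<Lambda> $$ (i, j) * d i (ext x i) (ext y i) \<le> A $$ (j, i) * d i (x i) (y i)" .
  qed
  finally show ?thesis .
qed

text \<open>
  In the weights \<open>w\<close>, the stability estimate is at most \<open>c\<close> times the \<open>j\<close>-th entry of
  \<open>A w\<close>. Stating the contraction with a bound \<open>c\<close> for the coordinates in \<open>\<I> j\<close> alone,
  instead of with a metric on the full product, allows the same form for functions of
  differing sets of variables.
\<close>

lemma component_weighted_contraction:
  assumes A: "stability_matrix n X d \<phi> \<I> F A" and j: "j < n"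
    and w_pos: "\<And>i. i < n \<Longrightarrow> 0 < w i"
    and Aw: "(\<Sum>i<n. A $$ (j, i) * w i) \<le> \<theta> * w j"
    and x: "\<And>i. i \<in> \<I> j \<Longrightarrow> x i \<in> X i" and y: "\<And>i. i \<in> \<I> j \<Longrightarrow> y i \<in> X i"
    and c: "0 \<le> c" "\<And>i. i \<in> \<I> j \<Longrightarrow> d i (x i) (y i) \<le> c * w i"
  shows "d j (component \<phi> \<I> F j x) (component \<phi> \<I> F j y) \<le> \<theta> * c * w j"
proof -
  have "d j (component \<phi> \<I> F j x) (component \<phi> \<I> F j y)
      \<le> (\<Sum>i\<in>\<I> j. A $$ (j, i) * d i (x i) (y i))"
    using A j x y by (rule stability_matrix_component)
  also have "\<dots> \<le> (\<Sum>i\<in>\<I> j. A $$ (j, i) * (c * w i))"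
    using c(2) index_subset[OF j] stability_matrix_nonneg[OF A j]
    by (intro sum_mono mult_left_mono) auto
  also have "\<dots> \<le> (\<Sum>i<n. A $$ (j, i) * (c * w i))"
    using c(1) w_pos index_subset[OF j] stability_matrix_nonneg[OF A j]
    by (intro sum_mono2) (auto simp: less_imp_le)
  also have "\<dots> = c * (\<Sum>i<n. A $$ (j, i) * w i)"
    by (simp add: sum_distrib_left mult.left_commute)
  also have "\<dots> \<le> c * (\<theta> * w j)" using Aw c(1) by (rule mult_left_mono)
  finally show ?thesis by (simp add: ac_simps)
qed

lemma subst_vars_subset:
  assumes "j < n"
  shows "subst_vars \<I> S j m \<subseteq> {..<n}"
  using assms index_subset by (induction m) fastforce+

lemma subst_fun_in_space:
  assumes j: "j < n" and "\<And>i. i \<in> subst_vars \<I> S j m \<Longrightarrow> x i \<in> X i"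
  shows "subst_fun \<phi> \<I> F S j m x \<in> X j"
  using assms(2)
proof (induction m arbitrary: x)
  case 0
  then show ?case using component_in_space[OF j] by simp
next
  case (Suc m)
  have "(\<lambda>l\<in>subst_vars \<I> S j m. if l \<in> S then x l else component \<phi> \<I> F l x) i \<in> X i"
    if "i \<in> subst_vars \<I> S j m" for i
    using that subst_vars_subset[OF j, of S m] Suc.prems
    by (auto intro!: component_in_space)
  then show ?case using Suc.IH by simp
qed

text \<open>
  Substitution preserves the bound: a variable kept by the step still differs by at most
  \<open>c w\<^sub>l\<close>, and a variable \<open>x\<^sub>l\<close> replaced by \<open>\<F>\<^sub>l\<close> differs by at most \<open>\<theta> c w\<^sub>l \<le> c w\<^sub>l\<close>.
\<close>

lemma subst_fun_weighted_contraction: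
  assumes A: "stability_matrix n X d \<phi> \<I> F A" and j: "j < n"
    and w_pos: "\<And>i. i < n \<Longrightarrow> 0 < w i"
    and Aw: "\<And>i. i < n \<Longrightarrow> (\<Sum>k<n. A $$ (i, k) * w k) \<le> \<theta> * w i" and \<theta>: "\<theta> \<le> 1"
    and c: "0 \<le> c"
    and "\<And>i. i \<in> subst_vars \<I> S j m \<Longrightarrow> x i \<in> X i"
    and "\<And>i. i \<in> subst_vars \<I> S j m \<Longrightarrow> y i \<in> X i"
    and "\<And>i. i \<in> subst_vars \<I> S j m \<Longrightarrow> d i (x i) (y i) \<le> c * w i"
  shows "d j (subst_fun \<phi> \<I> F S j m x) (subst_fun \<phi> \<I> F S j m y) \<le> \<theta> * c * w j"
  using assms(7-9)
proof (induction m arbitrary: x y)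
  case 0
  then show ?case
    using component_weighted_contraction[OF A j w_pos Aw[OF j]] c by simp
next
  case (Suc m)
  let ?V = "subst_vars \<I> S j m"
  let ?s = "\<lambda>z. \<lambda>l\<in>?V. if l \<in> S then z l else component \<phi> \<I> F l z"
  have lt: "l < n" if "l \<in> ?V" for l using that subst_vars_subset[OF j, of S m] by auto
  have "?s x i \<in> X i" "?s y i \<in> X i" if "i \<in> ?V" for i
    using that lt[OF that] Suc.prems(1,2) by (auto intro!: component_in_space)
  moreover have "d i (?s x i) (?s y i) \<le> c * w i" if i: "i \<in> ?V" for i
  proof (cases "i \<in> S")
    case True
    then show ?thesis using i Suc.prems(3) by simp
  next
    case False
    have sub: "\<I> i \<subseteq> subst_vars \<I> S j (Suc m)" using i False by auto
    have "d i (component \<phi> \<I> F i x) (component \<phi> \<I> F i y) \<le> \<theta> * c * w i"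
      using sub Suc.prems
      by (intro component_weighted_contraction[OF A lt[OF i] w_pos Aw[OF lt[OF i]] _ _ c]) blast+
    also have "\<dots> \<le> 1 * c * w i"
      using \<theta> c w_pos[OF lt[OF i]] by (intro mult_right_mono) auto
    finally show ?thesis using i False by simp
  qed
  ultimately have "d j (subst_fun \<phi> \<I> F S j m (?s x)) (subst_fun \<phi> \<I> F S j m (?s y)) \<le> \<theta> * c * w j"
    by (rule Suc.IH)
  then show ?case by simp
qed

end

section \<open>The restriction to a complete structural set\<close>

theorem theorem6p2:
  fixes n :: nat
    and X :: "nat \<Rightarrow> 'a set"
    and d :: "nat \<Rightarrow> 'a \<Rightarrow> 'a \<Rightarrow> real"
    and \<phi> :: "nat \<Rightarrow> 'a \<Rightarrow> 'a"
    and \<I> :: "nat \<Rightarrow> nat set"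
    and F :: "nat \<Rightarrow> (nat \<Rightarrow> 'a) \<Rightarrow> 'a"
    and A :: "real mat"
    and S :: "nat set"
  assumes "dynamical_network n X d \<phi> \<I> F"
    and "stability_matrix n X d \<phi> \<I> F A"
    and "spectral_radius (map_mat complex_of_real A) < 1"
    and "complete_structural_set (interaction_graph n \<I>) S"
  shows "\<exists>z. globally_attracting_fixed_point (Pi\<^sub>E S X) (dmax S d) (restriction \<phi> \<I> F S) z"
proof -
  interpret dynamical_network n X d \<phi> \<I> F by fact
  note A = assms(2)
  have S_sub: "S \<subseteq> {..<n}" and S_fin: "finite S"
    using assms(4) by (auto simp: complete_structural_set_def interaction_graph_def
        intro: finite_subset)
  have S_ne: "S \<noteq> {}"
    using assms(4) n_pos by (force simp: complete_structural_set_def interaction_graph_def)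
  have lt: "i < n" if "i \<in> S" for i using that S_sub by auto
  obtain w \<theta> where \<theta>: "0 < \<theta>" "\<theta> < 1" and w: "\<And>i. i < n \<Longrightarrow> 0 < w i"
    and Aw: "\<And>i. i < n \<Longrightarrow> (\<Sum>j<n. A $$ (i, j) * w j) \<le> \<theta> * w i"
    by (rule nonneg_mat_subinvariant_weights
        [OF stability_matrix_carrier[OF A] n_pos stability_matrix_nonneg[OF A] assms(3)])
      (assumption, assumption, rule that)
  define D where "D = dmax S (\<lambda>i a b. d i a b / w i)"
  have scaled: "Metric_space (X i) (\<lambda>a b. d i a b / w i)"
    "Metric_space.mcomplete (X i) (\<lambda>a b. d i a b / w i)" if "i \<in> S" for i
    using Metric_space_divide mcomplete_divide metric complete w lt[OF that] by blast+
  interpret D: Metric_space "Pi\<^sub>E S X" D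
    unfolding D_def using S_fin S_ne scaled(1) by (rule Metric_space_dmax)
  have D_complete: "D.mcomplete"
    unfolding D_def using S_fin S_ne scaled by (rule mcomplete_dmax)
  have d_le_D: "d i (x i) (y i) \<le> D x y * w i" if "i \<in> S" for i x y
    using le_dmax[OF S_fin that, of "\<lambda>i a b. d i a b / w i" x y] w[OF lt[OF that]]
    by (simp add: D_def pos_divide_le_eq)
  define m where "m j = (LEAST m. subst_vars \<I> S j m \<subseteq> S)" for j
  have vars: "subst_vars \<I> S j (m j) \<subseteq> S" if "j \<in> S" for j
    unfolding m_def
    using complete_structural_set_subst_vars[OF assms(4) lt[OF that]] by (rule LeastI_ex)
  let ?R = "restriction \<phi> \<I> F S"
  have R: "?R x j = subst_fun \<phi> \<I> F S j (m j) x" if "j \<in> S" for x j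
    using that by (simp add: restriction_def m_def)
  have R_maps: "?R \<in> Pi\<^sub>E S X \<rightarrow> Pi\<^sub>E S X"
  proof (intro funcsetI PiE_I)
    fix x j assume x: "x \<in> Pi\<^sub>E S X" and j: "j \<in> S"
    show "?R x j \<in> X j"
      unfolding R[OF j] using x vars[OF j] by (intro subst_fun_in_space lt[OF j]) (auto simp: PiE_mem)
  qed (simp add: restriction_def)
  have R_contr: "D (?R x) (?R y) \<le> \<theta> * D x y" if xy: "x \<in> Pi\<^sub>E S X" "y \<in> Pi\<^sub>E S X" for x y
  proof -
    have "d j (?R x j) (?R y j) / w j \<le> \<theta> * D x y" if j: "j \<in> S" for j
    proof -
      have "d j (?R x j) (?R y j) \<le> \<theta> * D x y * w j"
        unfolding R[OF j]
        using vars[OF j] xy \<theta>(2) d_le_D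
        by (intro subst_fun_weighted_contraction[OF A lt[OF j] w Aw _ D.nonneg])
          (auto simp: PiE_mem subset_iff)
      then show ?thesis using w[OF lt[OF j]] by (simp add: pos_divide_le_eq)
    qed
    then show ?thesis by (simp add: D_def dmax_le_iff[OF S_fin S_ne])
  qed
  have "Pi\<^sub>E S X \<noteq> {}" using space_nonempty lt by (simp add: PiE_eq_empty_iff)
  then obtain z where z: "globally_attracting_fixed_point (Pi\<^sub>E S X) D ?R z"
    by (rule D.contraction_globally_attracting
        [OF D_complete _ R_maps less_imp_le[OF \<theta>(1)] \<theta>(2) R_contr]) (assumption, assumption, rule that)
  \<comment> \<open>It remains to pass from the weighted metric \<open>D\<close> to the maximum metric.\<close>
  define W where "W = Max (w ` S)"
  have d_le: "dmax S d x y \<le> W * D x y" and d_ge: "0 \<le> dmax S d x y" for x y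
  proof -
    show "dmax S d x y \<le> W * D x y"
      unfolding dmax_le_iff[OF S_fin S_ne]
    proof
      fix i assume i: "i \<in> S"
      have "w i \<le> W" unfolding W_def using S_fin i by simp
      then show "d i (x i) (y i) \<le> W * D x y"
        using d_le_D[OF i, of x y] mult_left_mono[of "w i" W "D x y"]
        by (simp add: mult.commute)
    qed
    show "0 \<le> dmax S d x y"
      using Metric_space.nonneg[OF Metric_space_dmax[OF S_fin S_ne]] metric lt by blast
  qed
  have "(\<lambda>k. dmax S d ((?R ^^ k) y) z) \<longlonglongrightarrow> 0" if y: "y \<in> Pi\<^sub>E S X" for y
  proof (rule Lim_null_comparison[OF always_eventually[OF allI]])
    show "norm (dmax S d ((?R ^^ k) y) z) \<le> W * D ((?R ^^ k) y) z" for k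
      using d_le d_ge by simp
    show "(\<lambda>k. W * D ((?R ^^ k) y) z) \<longlonglongrightarrow> 0"
      using z y by (intro tendsto_mult_right_zero) (simp add: globally_attracting_fixed_point_def)
  qed
  then show ?thesis using z unfolding globally_attracting_fixed_point_def by blast
qed

end
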